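(* Let $n$ be a nonnegative integer, and let $P_n(x)$ and $Q_n(x)$ be the derivative polynomials for tangent and secant, defined by the exponential generating functions $$\frac{x+\tan (t)}{1-x \tan (t)}= \sum_{n=0}^{\infty} P_n(x)\,\frac{t^n}{n!},\qquad \frac{\sec (t)}{1-x \tan (t)}= \sum_{n=0}^{\infty} Q_n(x)\,\frac{t^n}{n!}.$$ Then, in terms of the tangent numbers of order $k$, $T(n,k)$, $$P_n(x)= T(n,1) +\sum_{k=1}^{n+1} \frac{1}{k}\,T(n+1,k)\,x^k,$$ and, in terms of the secant numbers of order $k$, $S(n,k)$, $$Q_n(x)=\sum_{k=0}^{n} S(n,k)\,x^k.$$
   Context: The tangent numbers of order $k$, $T(n,k)$, are defined for integers $k\ge 1$ by the power series expansion at $t=0$ $$\tan^{k}(t)=\sum_{n = k}^{\infty} T(n,k)\,\frac{t^n}{n!},$$ and the secant numbers of order $k$, $S(n,k)$, are defined for integers $k\ge 0$ by $$\sec(t) \tan^{k}(t)=\sum_{n = k}^{\infty} S(n,k)\,\frac{t^n}{n!}.$$ By convention $T(n,k)=0$ and $S(n,k)=0$ for $0\le n<k$ (in particular $T(0,1)=0$). The generating functions for $P_n(x)$ and $Q_n(x)$ are expanded as power series in $t$ at $t=0$, with coefficients polynomials in $x$. *)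

theory Defs
  imports "HOL-Analysis.Analysis"
begin

text \<open>
  The numbers are taken as reals, and \<open>sec\<close> is \<^term>\<open>inverse (fps_cos 1)\<close>.  The values for
  \<open>n < k\<close> are not set by hand: they vanish because the series has subdegree \<open>k\<close>.
\<close>

definition tangent_num :: "nat \<Rightarrow> nat \<Rightarrow> real" where
  "tangent_num n k = fact n * fps_nth (fps_tan 1 ^ k) n"

definition secant_num :: "nat \<Rightarrow> nat \<Rightarrow> real" where
  "secant_num n k = fact n * fps_nth (inverse (fps_cos 1) * fps_tan 1 ^ k) n"

text \<open>
  The generating functions of the derivative polynomials live in \<^typ>\<open>real poly fps\<close>: the outer
  variable is \<open>t\<close>, the polynomial variable is \<open>x\<close>.  Division of power series is only available
  over coefficient types with an inverse; the denominator has constant coefficient \<open>1\<close>, so its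
  inverse over \<^typ>\<open>real poly\<close> is \<^term>\<open>\<lambda>f. fps_right_inverse f 1\<close>.
\<close>

definition lift_fps :: "real fps \<Rightarrow> real poly fps" where
  "lift_fps f = Abs_fps (\<lambda>n. [:fps_nth f n:])"

definition x_fps :: "real poly fps" where
  "x_fps = fps_const [:0, 1:]"

definition tan_deriv_gf :: "real poly fps" where
  "tan_deriv_gf = (x_fps + lift_fps (fps_tan 1)) *
     fps_right_inverse (1 - x_fps * lift_fps (fps_tan 1)) 1"

definition sec_deriv_gf :: "real poly fps" where
  "sec_deriv_gf = lift_fps (inverse (fps_cos 1)) *
     fps_right_inverse (1 - x_fps * lift_fps (fps_tan 1)) 1"

definition tan_deriv_poly :: "nat \<Rightarrow> real poly" where
  "tan_deriv_poly n = smult (fact n) (fps_nth tan_deriv_gf n)"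

definition sec_deriv_poly :: "nat \<Rightarrow> real poly" where
  "sec_deriv_poly n = smult (fact n) (fps_nth sec_deriv_gf n)"

lemma denominator_mult_right_inverse:
  "(1 - x_fps * lift_fps (fps_tan 1)) *
     fps_right_inverse (1 - x_fps * lift_fps (fps_tan 1)) 1 = 1"
  by (rule fps_right_inverse) (simp add: x_fps_def lift_fps_def fps_tan_def)

lemma tan_deriv_gf_mult:
  "tan_deriv_gf * (1 - x_fps * lift_fps (fps_tan 1)) = x_fps + lift_fps (fps_tan 1)"
  unfolding tan_deriv_gf_def mult.assoc
  by (subst mult.commute[of "fps_right_inverse _ _"])
     (simp only: denominator_mult_right_inverse mult_1_right)

lemma sec_deriv_gf_mult:
  "sec_deriv_gf * (1 - x_fps * lift_fps (fps_tan 1)) = lift_fps (inverse (fps_cos 1))"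
  unfolding sec_deriv_gf_def mult.assoc
  by (subst mult.commute[of "fps_right_inverse _ _"])
     (simp only: denominator_mult_right_inverse mult_1_right)

text \<open>
  The formal definitions agree with the expansions at \<open>t = 0\<close> of the actual functions, for every
  real \<open>x\<close>.
\<close>

definition eval_coeffs :: "real \<Rightarrow> real poly fps \<Rightarrow> real fps" where
  "eval_coeffs x F = Abs_fps (\<lambda>n. poly (fps_nth F n) x)"

lemma eval_coeffs_simps:
  "eval_coeffs x (F + G) = eval_coeffs x F + eval_coeffs x G"
  "eval_coeffs x (F - G) = eval_coeffs x F - eval_coeffs x G"
  "eval_coeffs x (F * G) = eval_coeffs x F * eval_coeffs x G"
  "eval_coeffs x 1 = 1"
  "eval_coeffs x x_fps = fps_const x"
  "eval_coeffs x (lift_fps f) = f"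
  by (auto simp: eval_coeffs_def fps_eq_iff fps_mult_nth poly_sum x_fps_def lift_fps_def)

lemma has_fps_expansion_tan_sec_nums:
  "(\<lambda>t. tan t ^ k) has_fps_expansion Abs_fps (\<lambda>n. tangent_num n k / fact n)"
  "(\<lambda>t. inverse (cos t) * tan t ^ k) has_fps_expansion Abs_fps (\<lambda>n. secant_num n k / fact n)"
proof -
  have pow: "(\<lambda>t::real. tan t ^ k) has_fps_expansion fps_tan 1 ^ k"
    by (induction k) (auto intro!: fps_expansion_intros)
  have sec: "(\<lambda>t::real. inverse (cos t)) has_fps_expansion inverse (fps_cos 1)"
    by (intro fps_expansion_intros) auto
  show "(\<lambda>t. tan t ^ k) has_fps_expansion Abs_fps (\<lambda>n. tangent_num n k / fact n)"
    using pow by (simp add: tangent_num_def fps_nth_inverse)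
  show "(\<lambda>t. inverse (cos t) * tan t ^ k) has_fps_expansion Abs_fps (\<lambda>n. secant_num n k / fact n)"
    using has_fps_expansion_mult[OF sec pow] by (simp add: secant_num_def fps_nth_inverse)
qed

lemma has_fps_expansion_deriv_polys:
  "(\<lambda>t. (x + tan t) / (1 - x * tan t)) has_fps_expansion
     Abs_fps (\<lambda>n. poly (tan_deriv_poly n) x / fact n)"
  "(\<lambda>t. inverse (cos t) / (1 - x * tan t)) has_fps_expansion
     Abs_fps (\<lambda>n. poly (sec_deriv_poly n) x / fact n)"
proof -
  let ?D = "1 - fps_const x * fps_tan (1::real)"
  have D0: "fps_nth ?D 0 \<noteq> 0"
    by (simp add: fps_tan_def)
  have tan: "(\<lambda>t::real. tan t) has_fps_expansion fps_tan 1"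
    by (rule has_fps_expansion_tan')
  have den: "(\<lambda>t. inverse (1 - x * tan t)) has_fps_expansion inverse ?D"
    using D0 by (intro fps_expansion_intros tan) auto
  have num: "(\<lambda>t. x + tan t) has_fps_expansion fps_const x + fps_tan 1"
    by (intro fps_expansion_intros tan)
  have sec: "(\<lambda>t::real. inverse (cos t)) has_fps_expansion inverse (fps_cos 1)"
    by (intro fps_expansion_intros) auto
  have quot: "G = F * inverse ?D" if "G * ?D = F" for F G
    using that D0 by (metis inverse_mult_eq_1' mult.assoc mult_1_right)
  have T: "Abs_fps (\<lambda>n. poly (tan_deriv_poly n) x / fact n) =
      (fps_const x + fps_tan 1) * inverse ?D"
    using arg_cong[OF tan_deriv_gf_mult, of "eval_coeffs x"]
    by (intro quot) (simp add: eval_coeffs_simps, simp add: eval_coeffs_def tan_deriv_poly_def)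
  have S: "Abs_fps (\<lambda>n. poly (sec_deriv_poly n) x / fact n) =
      inverse (fps_cos 1) * inverse ?D"
    using arg_cong[OF sec_deriv_gf_mult, of "eval_coeffs x"]
    by (intro quot) (simp add: eval_coeffs_simps, simp add: eval_coeffs_def sec_deriv_poly_def)
  show "(\<lambda>t. (x + tan t) / (1 - x * tan t)) has_fps_expansion
     Abs_fps (\<lambda>n. poly (tan_deriv_poly n) x / fact n)"
    unfolding T unfolding divide_inverse by (rule has_fps_expansion_mult[OF num den])
  show "(\<lambda>t. inverse (cos t) / (1 - x * tan t)) has_fps_expansion
     Abs_fps (\<lambda>n. poly (sec_deriv_poly n) x / fact n)"
    unfolding S unfolding divide_inverse by (rule has_fps_expansion_mult[OF sec den])
qed

end

theory Submission
  imports Defs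
begin

text \<open>
  A bivariate series in \<open>t\<close> and \<open>x\<close> can be read off either by powers of \<open>t\<close>, which gives the
  polynomials \<open>P\<^sub>n\<close> and \<open>Q\<^sub>n\<close>, or by powers of \<open>x\<close>.  Clearing the denominator, a generating
  function \<open>F\<close> with numerator \<open>N\<close> satisfies \<open>F = N + x tan(t) F\<close>, so the coefficient of
  \<open>x\<^sup>k\<close> (a series in \<open>t\<close>) obeys a one-step recursion in \<open>k\<close> with factor \<open>tan t\<close>.  For the
  secant this gives \<open>sec t tan\<^sup>k t\<close>, whose coefficients are the \<open>S(n,k)\<close> by definition.
  For the tangent it gives \<open>tan t\<close> at \<open>k = 0\<close> and, for \<open>k \<ge> 1\<close>,
  \[ \tan^{k-1} t\,(1 + \tan^2 t) = \frac{1}{k} \frac{d}{dt} \tan^k t, \]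
  since \<open>tan' = 1 + tan\<^sup>2\<close>.  The derivative shifts \<open>T(n,k)\<close> to \<open>T(n+1,k)\<close>, which is where
  the factor \<open>1/k\<close> and the index \<open>n + 1\<close> come from.  The sums over \<open>k\<close> are finite because
  \<open>tan\<^sup>k t\<close> vanishes to order \<open>k\<close> at \<open>t = 0\<close>.
\<close>

definition x_slice :: "nat \<Rightarrow> 'a::zero poly fps \<Rightarrow> 'a fps" where
  "x_slice k F = Abs_fps (\<lambda>n. coeff (fps_nth F n) k)"

lemma x_slice_nth [simp]: "fps_nth (x_slice k F) n = coeff (fps_nth F n) k"
  by (simp add: x_slice_def)

lemma x_slice_add: "x_slice k (F + G) = x_slice k F + x_slice k G"
  for F G :: "'a::comm_monoid_add poly fps"
  by (simp add: fps_eq_iff)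

lemma x_slice_lift: "x_slice k (lift_fps f) = (if k = 0 then f else 0)"
  by (cases k) (auto simp: fps_eq_iff lift_fps_def)

lemma x_slice_lift_mult: "x_slice k (lift_fps f * F) = f * x_slice k F"
  by (simp add: fps_eq_iff lift_fps_def fps_mult_nth coeff_sum)

lemma x_slice_x_fps: "x_slice k x_fps = (if k = 1 then 1 else 0)"
  by (auto simp: fps_eq_iff x_fps_def coeff_pCons split: nat.split)

lemma x_slice_x_fps_mult: "x_slice k (x_fps * F) = (case k of 0 \<Rightarrow> 0 | Suc j \<Rightarrow> x_slice j F)"
  by (auto simp: fps_eq_iff x_fps_def coeff_pCons split: nat.split)

text \<open>
  Comparing powers of \<open>x\<close> in \<open>F = N + x f F\<close> divides by \<open>1 - x f\<close> without inverting anything.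
\<close>

lemma x_slice_quotient:
  assumes "F * (1 - x_fps * lift_fps f) = N"
  shows "x_slice 0 F = x_slice 0 N"
    and "x_slice (Suc k) F = x_slice (Suc k) N + f * x_slice k F"
proof -
  have "F = N + x_fps * (lift_fps f * F)"
    unfolding assms [symmetric] by (simp add: algebra_simps)
  then have "x_slice j F = x_slice j N + x_slice j (x_fps * (lift_fps f * F))" for j
    by (metis x_slice_add)
  from this [of 0] this [of "Suc k"]
  show "x_slice 0 F = x_slice 0 N"
    and "x_slice (Suc k) F = x_slice (Suc k) N + f * x_slice k F"
    by (simp_all add: x_slice_x_fps_mult x_slice_lift_mult)
qed

lemma x_slice_sec_deriv_gf: "x_slice k sec_deriv_gf = inverse (fps_cos 1) * fps_tan 1 ^ k"
  by (induction k)
     (simp_all add: x_slice_quotient [OF sec_deriv_gf_mult] x_slice_lift algebra_simps)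

text \<open>
  Here the numerator \<open>x + tan t\<close> also contributes at \<open>k = 1\<close>, so the geometric progression with
  ratio \<open>tan t\<close> starts only there, from \<open>1 + tan\<^sup>2 t\<close>.
\<close>

lemma x_slice_tan_deriv_gf:
  "x_slice 0 tan_deriv_gf = fps_tan 1"
  "x_slice (Suc k) tan_deriv_gf = fps_tan 1 ^ k * (1 + fps_tan 1 ^ 2)"
proof -
  note slices = x_slice_quotient [OF tan_deriv_gf_mult] x_slice_add x_slice_lift x_slice_x_fps
  show "x_slice 0 tan_deriv_gf = fps_tan 1"
    by (simp add: slices)
  show "x_slice (Suc k) tan_deriv_gf = fps_tan 1 ^ k * (1 + fps_tan 1 ^ 2)"
    by (induction k) (simp_all add: slices power2_eq_square algebra_simps)
qed

lemma fps_deriv_tan_1: "fps_deriv (fps_tan (1::'a::field_char_0)) = 1 + fps_tan 1 ^ 2"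
proof -
  let ?c = "fps_cos (1::'a)" and ?s = "fps_sin (1::'a)"
  have c0: "fps_nth ?c 0 \<noteq> 0" by simp
  have unit: "?c * inverse ?c = 1"
    using c0 by (rule inverse_mult_eq_1')
  have tan: "fps_tan (1::'a) = ?s * inverse ?c"
    using c0 by (simp add: fps_tan_def fps_divide_unit)
  have "fps_deriv (fps_tan (1::'a)) = inverse (?c ^ 2)"
    by (simp add: fps_tan_deriv fps_divide_unit)
  also have "\<dots> = (?c ^ 2 + ?s ^ 2) * inverse ?c ^ 2"
    by (simp add: fps_sin_cos_sum_of_squares fps_inverse_power)
  also have "\<dots> = (?c * inverse ?c) ^ 2 + (?s * inverse ?c) ^ 2"
    by (simp add: power_mult_distrib distrib_right)
  finally show ?thesis
    by (simp add: unit tan)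
qed

lemma fps_tan_power_nth_eq_0: "n < k \<Longrightarrow> fps_nth (fps_tan (1::'a::field_char_0) ^ k) n = 0"
  by (rule startsby_zero_power_prefix [rule_format]) (auto simp: fps_tan_def)

lemma tangent_num_eq_0: "n < k \<Longrightarrow> tangent_num n k = 0"
  by (simp add: tangent_num_def fps_tan_power_nth_eq_0)

lemma secant_num_eq_0: "n < k \<Longrightarrow> secant_num n k = 0"
  by (auto simp: secant_num_def fps_mult_nth fps_tan_power_nth_eq_0 intro!: sum.neutral)

lemma coeff_sec_deriv_poly: "coeff (sec_deriv_poly n) k = secant_num n k"
  by (simp add: sec_deriv_poly_def secant_num_def flip: x_slice_sec_deriv_gf)

lemma coeff_tan_deriv_poly_0: "coeff (tan_deriv_poly n) 0 = tangent_num n 1"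
  by (simp add: tan_deriv_poly_def tangent_num_def flip: x_slice_tan_deriv_gf(1))

lemma coeff_tan_deriv_poly_Suc:
  "coeff (tan_deriv_poly n) (Suc k) = 1 / real (Suc k) * tangent_num (n + 1) (Suc k)"
proof -
  let ?T = "fps_tan (1::real)"
  have "fps_deriv (?T ^ Suc k) = fps_const (real (Suc k)) * x_slice (Suc k) tan_deriv_gf"
    by (simp only: fps_deriv_power fps_deriv_tan_1 x_slice_tan_deriv_gf diff_Suc_1)
       (simp add: algebra_simps)
  then have "real (n + 1) * fps_nth (?T ^ Suc k) (n + 1) =
      real (Suc k) * coeff (fps_nth tan_deriv_gf n) (Suc k)"
    by (metis fps_deriv_nth fps_mult_left_const_nth x_slice_nth)
  then have "coeff (fps_nth tan_deriv_gf n) (Suc k) =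
      real (n + 1) * fps_nth (?T ^ Suc k) (n + 1) / real (Suc k)"
    by (simp add: field_simps del: power_Suc)
  then show ?thesis
    by (simp add: tan_deriv_poly_def tangent_num_def del: power_Suc)
qed

theorem theorem1:
  fixes n :: nat
  shows "tan_deriv_poly n =
           [:tangent_num n 1:] + (\<Sum>k=1..n+1. monom (1 / real k * tangent_num (n + 1) k) k) \<and>
         sec_deriv_poly n = (\<Sum>k=0..n. monom (secant_num n k) k)"
proof
  show "tan_deriv_poly n =
      [:tangent_num n 1:] + (\<Sum>k=1..n+1. monom (1 / real k * tangent_num (n + 1) k) k)"
  proof (rule poly_eqI)
    fix j
    show "coeff (tan_deriv_poly n) j = coeff ([:tangent_num n 1:] +
        (\<Sum>k=1..n+1. monom (1 / real k * tangent_num (n + 1) k) k)) j"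
    proof (cases j)
      case 0
      then show ?thesis
        by (simp add: coeff_tan_deriv_poly_0 coeff_sum)
    next
      case (Suc i)
      then show ?thesis
        by (simp add: coeff_tan_deriv_poly_Suc coeff_sum tangent_num_eq_0)
    qed
  qed
  show "sec_deriv_poly n = (\<Sum>k=0..n. monom (secant_num n k) k)"
    by (rule poly_eqI) (simp add: coeff_sec_deriv_poly coeff_sum secant_num_eq_0)
qed

end
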